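(* For any $\delta\in(0,1)$ and any integers $0=k_0<k_1<\dots<k_t<n\le m$, there is a matrix $\mathbf A\in\mathbb R^{m\times n}$ such that for every $i\in\{1,\dots,t\}$ and every subset $S\subseteq\{1,\dots,n\}$ with $|S|=k_i$, \[ \frac{\mathrm{Er}_{\mathbf A}(S)}{\mathrm{OPT}_{k_i}}\ge(1-\delta)(k_i-k_{i-1}). \]
   Context: For $\mathbf A\in\mathbb R^{m\times n}$ with columns $\mathbf a_1,\dots,\mathbf a_n$ and $S\subseteq\{1,\dots,n\}$, $\mathbf P_S$ denotes the orthogonal projection onto $\mathrm{span}\{\mathbf a_i:i\in S\}$ and $\mathrm{Er}_{\mathbf A}(S)=\|\mathbf A-\mathbf P_S\mathbf A\|_F^2$. $\mathrm{OPT}_k=\min_{\mathrm{rank}(\mathbf B)=k}\|\mathbf A-\mathbf B\|_F^2$ (Frobenius norm). *)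

theory Defs
  imports "HOL-Analysis.Analysis"
begin

text \<open>Orthogonal projection of x onto a subspace V: the unique p in V with x - p orthogonal to V.\<close>
definition orth_proj :: "'a::euclidean_space set \<Rightarrow> 'a \<Rightarrow> 'a" where
  "orth_proj V x = (THE p. p \<in> V \<and> (\<forall>v\<in>V. (x - p) \<bullet> v = 0))"

text \<open>Squared Frobenius norm of a real matrix.\<close>
definition frob_sq :: "real^'n^'m \<Rightarrow> real" where
  "frob_sq M = (\<Sum>i\<in>UNIV. \<Sum>j\<in>UNIV. (M $ i $ j)\<^sup>2)"

text \<open>P_S A: apply the orthogonal projection onto span of the columns indexed by S to every column of A.\<close>
definition projS :: "real^'n^'m \<Rightarrow> 'n set \<Rightarrow> real^'n^'m" where
  "projS A S = (\<chi> i j. orth_proj (span ((\<lambda>l. column l A) ` S)) (column j A) $ i)"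

definition Er :: "real^'n^'m \<Rightarrow> 'n set \<Rightarrow> real" where
  "Er A S = frob_sq (A - projS A S)"

definition OPT :: "real^'n^'m \<Rightarrow> nat \<Rightarrow> real" where
  "OPT A k = Inf {frob_sq (A - B) | B. rank B = k}"

end

theory Submission
  imports Defs
begin

(*
  Split the coordinates into blocks G_1, ..., G_t with |G_1 u ... u G_i| = k_i + 1, and let A act
  on G_j as c_j (I - (1 - eta)/|G_j| J), with eta = delta/(2n) and geometric scales
  c_j = eta^(2j); the remaining m - n rows are zero.  Block j has singular value c_j on the
  vectors summing to zero over G_j and c_j eta on the constant vector.  Dropping this direction
  of block i together with all later blocks leaves a matrix of rank k_i, so
  OPT_{k_i} <= (c_i eta)^2 (1 + delta/4).

  A set S of k_i columns misses some column l of G_1 u ... u G_i, say l in G_j.  The dual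
  vector nu_l with nu_l^T A = c_j e_l^T is orthogonal to the columns in S, whence
  Er(S) >= c_j^2 / |nu_l|^2 = c_j^2 eta^2 |G_j| / (1 + eta^2 (|G_j| - 1)).  For j = i this is
  about (k_i - k_{i-1}) (c_i eta)^2 since |G_i| >= k_i - k_{i-1}; for j < i the factor
  c_j / c_i >= eta^(-2) is large enough.  The same dual vectors show that A is boundedly
  injective on vectors supported on the blocks, so every matrix of rank k_i < |G_1 u ... u G_t|
  stays away from A and OPT_{k_i} > 0.
*)

section \<open>Residuals and low-rank approximation\<close>

lemma orth_proj_mem:
  fixes V :: "'a::euclidean_space set"
  assumes "subspace V"
  shows "orth_proj V x \<in> V"
proof -
  have spV: "span V = V" using assms by (simp add: span_eq_iff)
  obtain y z where y: "y \<in> V" and z: "\<And>w. w \<in> V \<Longrightarrow> z \<bullet> w = 0" and xyz: "x = y + z"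
    using orthogonal_subspace_decomp_exists[of V x] spV by (auto simp: orthogonal_def)
  have "\<exists>!p. p \<in> V \<and> (\<forall>v\<in>V. (x - p) \<bullet> v = 0)"
  proof (rule ex1I[of _ y])
    show "y \<in> V \<and> (\<forall>v\<in>V. (x - y) \<bullet> v = 0)"
      using y z xyz by simp
  next
    fix p assume p: "p \<in> V \<and> (\<forall>v\<in>V. (x - p) \<bullet> v = 0)"
    have "p - y \<in> V" using p y assms by (simp add: subspace_diff)
    then have "(x - p) \<bullet> (p - y) = 0" and "(x - y) \<bullet> (p - y) = 0"
      using p z xyz by auto
    then have "(p - y) \<bullet> (p - y) = 0"
      by (simp add: inner_diff_left inner_diff_right algebra_simps)
    then show "p = y" by simp
  qed
  then show ?thesis unfolding orth_proj_def by (rule theI'[THEN conjunct1])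
qed

lemma frob_sq_nonneg: "0 \<le> frob_sq M"
  unfolding frob_sq_def by (intro sum_nonneg) auto

lemma inner_column_self_le_frob_sq: "column j M \<bullet> column j M \<le> frob_sq M"
proof -
  have "column j M \<bullet> column j M = (\<Sum>i\<in>UNIV. (M $ i $ j)\<^sup>2)"
    by (simp add: inner_vec_def column_def power2_eq_square)
  also have "\<dots> \<le> (\<Sum>i\<in>UNIV. \<Sum>j\<in>UNIV. (M $ i $ j)\<^sup>2)"
    by (intro sum_mono member_le_sum) auto
  finally show ?thesis unfolding frob_sq_def .
qed

lemma inner_mult_self_le_frob_sq: "(M *v z) \<bullet> (M *v z) \<le> frob_sq M * (z \<bullet> z)"
proof -
  have "(M *v z) \<bullet> (M *v z) = (\<Sum>r\<in>UNIV. (M $ r \<bullet> z)\<^sup>2)"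
    by (simp add: inner_vec_def[of "M *v z"] matrix_vector_mul_component power2_eq_square)
  also have "\<dots> \<le> (\<Sum>r\<in>UNIV. (M $ r \<bullet> M $ r) * (z \<bullet> z))"
    by (intro sum_mono Cauchy_Schwarz_ineq)
  also have "\<dots> = frob_sq M * (z \<bullet> z)"
    by (simp add: frob_sq_def inner_vec_def power2_eq_square sum_distrib_right)
  finally show ?thesis .
qed

lemma vector_matrix_mult_component: "(x v* M) $ j = x \<bullet> column j M"
  by (simp add: vector_matrix_mult_def inner_vec_def column_def mult.commute)

lemma column_projS: "column l (projS A S) = orth_proj (span ((\<lambda>j. column j A) ` S)) (column l A)"
  by (simp add: projS_def column_def vec_eq_iff)

text \<open>\<nu> annihilates the projection of column l onto the span of the columns in S, so
  \<nu> \<bullet> a_l = \<nu> \<bullet> (a_l - P_S a_l); then apply Cauchy--Schwarz.\<close>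
lemma Er_ge_inner_column:
  fixes A :: "real^'n^'m"
  assumes "\<forall>j\<in>S. \<nu> \<bullet> column j A = 0"
  shows "(\<nu> \<bullet> column l A)\<^sup>2 \<le> (\<nu> \<bullet> \<nu>) * Er A S"
proof -
  define w where "w = column l (A - projS A S)"
  have "column l (projS A S) \<in> span ((\<lambda>j. column j A) ` S)"
    unfolding column_projS by (simp add: orth_proj_mem)
  then have "orthogonal \<nu> (column l (projS A S))"
    by (rule orthogonal_to_span) (use assms in \<open>auto simp: orthogonal_def\<close>)
  then have "\<nu> \<bullet> column l (projS A S) = 0"
    by (simp add: orthogonal_def)
  moreover have "w = column l A - column l (projS A S)"
    unfolding w_def by (simp add: column_def vec_eq_iff)
  ultimately have "\<nu> \<bullet> w = \<nu> \<bullet> column l A"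
    by (simp add: inner_diff_right)
  moreover have "(\<nu> \<bullet> w)\<^sup>2 \<le> (\<nu> \<bullet> \<nu>) * (w \<bullet> w)" by (rule Cauchy_Schwarz_ineq)
  moreover have "w \<bullet> w \<le> Er A S"
    unfolding w_def Er_def by (rule inner_column_self_le_frob_sq)
  ultimately show ?thesis
    by (metis inner_ge_zero mult_left_mono order_trans)
qed

lemma ex_kernel_vector_in_subspace:
  fixes B :: "real^'n^'m"
  assumes "subspace Y" "rank B < dim Y"
  obtains z where "z \<in> Y" "z \<noteq> 0" "B *v z = 0"
proof -
  have "\<not> inj_on ((*v) B) Y"
  proof
    assume inj: "inj_on ((*v) B) Y"
    have "dim ((*v) B ` Y) = dim Y"
      by (rule dim_image_eq) (auto simp: span_eq_iff[THEN iffD2, OF assms(1)] inj)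
    moreover have "dim ((*v) B ` Y) \<le> rank B"
      unfolding rank_dim_range by (rule dim_subset) auto
    ultimately show False using assms(2) by simp
  qed
  then obtain x y where "x \<in> Y" "y \<in> Y" "x \<noteq> y" "B *v x = B *v y"
    unfolding inj_on_def by blast
  then show ?thesis
    using assms(1) that[of "x - y"] by (simp add: subspace_diff matrix_vector_mult_diff_distrib)
qed

text \<open>B annihilates some nonzero z in Y, on which A - B agrees with A.\<close>
lemma frob_sq_diff_ge_of_rank_lt:
  fixes A B :: "real^'n^'m"
  assumes "subspace Y" "rank B < dim Y"
    and "\<And>z. z \<in> Y \<Longrightarrow> z \<bullet> z \<le> K * ((A *v z) \<bullet> (A *v z))"
  shows "1 \<le> K * frob_sq (A - B)"
proof -
  obtain z where z: "z \<in> Y" "z \<noteq> 0" "B *v z = 0"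
    using ex_kernel_vector_in_subspace assms(1,2) by blast
  have zz: "0 < z \<bullet> z" using z(2) by simp
  have Az: "z \<bullet> z \<le> K * ((A *v z) \<bullet> (A *v z))" using assms(3)[OF z(1)] .
  then have "0 < K * ((A *v z) \<bullet> (A *v z))" using zz by linarith
  then have K: "0 < K" using inner_ge_zero[of "A *v z"] by (auto simp: zero_less_mult_iff)
  have "(A - B) *v z = A *v z" using z(3) by (simp add: matrix_vector_mult_diff_rdistrib)
  then have "(A *v z) \<bullet> (A *v z) \<le> frob_sq (A - B) * (z \<bullet> z)"
    using inner_mult_self_le_frob_sq[of "A - B" z] by simp
  with Az K have "1 * (z \<bullet> z) \<le> (K * frob_sq (A - B)) * (z \<bullet> z)"
    by (smt (verit) mult.assoc mult_left_mono)
  then show ?thesis using zz by (rule mult_right_le_imp_le)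
qed

lemma OPT_le: "rank B = k \<Longrightarrow> OPT A k \<le> frob_sq (A - B)"
  unfolding OPT_def by (rule cInf_lower) (auto intro: bdd_belowI[of _ 0] simp: frob_sq_nonneg)

lemma OPT_ge:
  fixes A B\<^sub>0 :: "real^'n^'m"
  assumes "rank B\<^sub>0 = k" and "\<And>B. rank B = k \<Longrightarrow> c \<le> frob_sq (A - B)"
  shows "c \<le> OPT A k"
  unfolding OPT_def using assms by (intro cInf_greatest) auto

section \<open>Padding with zero rows\<close>

definition embed_vec :: "('n \<Rightarrow> 'm) \<Rightarrow> real^'n \<Rightarrow> real^'m" where
  "embed_vec \<iota> x = (\<chi> r. if r \<in> range \<iota> then x $ inv \<iota> r else 0)"

definition embed_rows :: "('n \<Rightarrow> 'm) \<Rightarrow> real^'k^'n \<Rightarrow> real^'k^'m" where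
  "embed_rows \<iota> X = (\<chi> r. if r \<in> range \<iota> then X $ inv \<iota> r else 0)"

lemma sum_embed:
  fixes \<iota> :: "'n::finite \<Rightarrow> 'm::finite" and f :: "'n \<Rightarrow> 'a::comm_monoid_add"
  assumes "inj \<iota>"
  shows "(\<Sum>r\<in>UNIV. if r \<in> range \<iota> then f (inv \<iota> r) else 0) = (\<Sum>p\<in>UNIV. f p)"
proof -
  have "(\<Sum>r\<in>UNIV. if r \<in> range \<iota> then f (inv \<iota> r) else 0) = (\<Sum>r\<in>range \<iota>. f (inv \<iota> r))"
    by (simp add: sum.If_cases Int_absorb1)
  also have "\<dots> = (\<Sum>p\<in>UNIV. f p)"
    using assms by (simp add: sum.reindex)
  finally show ?thesis .
qed

lemma inner_embed_vec:
  assumes "inj \<iota>"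
  shows "embed_vec \<iota> x \<bullet> embed_vec \<iota> y = x \<bullet> y"
proof -
  have "embed_vec \<iota> x \<bullet> embed_vec \<iota> y
      = (\<Sum>r\<in>UNIV. if r \<in> range \<iota> then x $ inv \<iota> r * y $ inv \<iota> r else 0)"
    unfolding inner_vec_def embed_vec_def by (intro sum.cong) auto
  also have "\<dots> = x \<bullet> y"
    unfolding inner_vec_def using sum_embed[OF assms, of "\<lambda>p. x $ p * y $ p"] by simp
  finally show ?thesis .
qed

lemma column_embed_rows: "column j (embed_rows \<iota> X) = embed_vec \<iota> (column j X)"
  by (simp add: column_def embed_rows_def embed_vec_def vec_eq_iff)

lemma embed_rows_diff: "embed_rows \<iota> X - embed_rows \<iota> Y = embed_rows \<iota> (X - Y)"
  by (simp add: embed_rows_def vec_eq_iff)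

lemma embed_rows_mult: "embed_rows \<iota> X *v x = embed_vec \<iota> (X *v x)"
  by (simp add: embed_rows_def embed_vec_def vec_eq_iff matrix_vector_mult_def)

lemma frob_sq_embed_rows:
  assumes "inj \<iota>"
  shows "frob_sq (embed_rows \<iota> X) = frob_sq X"
proof -
  have "frob_sq (embed_rows \<iota> X)
      = (\<Sum>r\<in>UNIV. if r \<in> range \<iota> then (\<Sum>j\<in>UNIV. (X $ inv \<iota> r $ j)\<^sup>2) else 0)"
    unfolding frob_sq_def embed_rows_def by (intro sum.cong) auto
  also have "\<dots> = frob_sq X"
    unfolding frob_sq_def using sum_embed[OF assms, of "\<lambda>p. \<Sum>j\<in>UNIV. (X $ p $ j)\<^sup>2"] by simp
  finally show ?thesis .
qed

lemma embed_vec_apply: "inj \<iota> \<Longrightarrow> embed_vec \<iota> x $ \<iota> p = x $ p"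
  by (simp add: embed_vec_def)

lemma linear_embed_vec: "linear (embed_vec \<iota>)"
  by (rule linearI) (auto simp: embed_vec_def vec_eq_iff)

lemma inj_embed_vec: "inj \<iota> \<Longrightarrow> inj (embed_vec \<iota>)"
  by (metis embed_vec_apply inj_def vec_eq_iff)

lemma rank_embed_rows:
  assumes "inj \<iota>"
  shows "rank (embed_rows \<iota> X) = rank X"
proof -
  have "range ((*v) (embed_rows \<iota> X)) = embed_vec \<iota> ` range ((*v) X)"
    by (auto simp: embed_rows_mult)
  then have "rank (embed_rows \<iota> X) = dim (embed_vec \<iota> ` range ((*v) X))"
    by (simp add: rank_dim_range)
  also have "\<dots> = dim (range ((*v) X))"
    by (rule dim_image_eq[OF linear_embed_vec]) (meson assms inj_embed_vec inj_on_subset subset_UNIV)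
  finally show ?thesis by (simp add: rank_dim_range)
qed

section \<open>Block matrices\<close>

definition block_size :: "('n \<Rightarrow> nat) \<Rightarrow> nat \<Rightarrow> nat" where
  "block_size blk j = card {p. blk p = j}"

text \<open>On each block G_j = {p. blk p = j}, j > 0, this is c_j (I - (1 - \<eta>)/|G_j| J):
  it scales vectors summing to zero over G_j by c_j and the constant vector by c_j \<eta>.
  Label 0 marks the coordinates outside every block.\<close>
definition block_matrix :: "('n::finite \<Rightarrow> nat) \<Rightarrow> (nat \<Rightarrow> real) \<Rightarrow> real \<Rightarrow> real^'n^'n" where
  "block_matrix blk c \<eta> = (\<chi> p q. if blk p = blk q \<and> blk p \<noteq> 0
      then c (blk p) * ((if p = q then 1 else 0) - (1 - \<eta>) / real (block_size blk (blk p))) else 0)"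

definition dual_vector :: "('n::finite \<Rightarrow> nat) \<Rightarrow> real \<Rightarrow> 'n \<Rightarrow> real^'n" where
  "dual_vector blk \<eta> l = (\<chi> p. (if p = l then 1 else 0) +
      (if blk p = blk l then (1 - \<eta>) / (\<eta> * real (block_size blk (blk l))) else 0))"

lemma block_size_pos: "0 < block_size blk (blk (l::'n::finite))"
  unfolding block_size_def by (rule card_gt_0_iff[THEN iffD2]) auto

lemma block_size_le_card: "block_size (blk :: 'n::finite \<Rightarrow> nat) j \<le> CARD('n)"
  unfolding block_size_def by (rule card_mono) auto

lemma sum_delta_minus_const:
  fixes f :: "'a \<Rightarrow> real"
  assumes "finite G" "q \<in> G"
  shows "(\<Sum>p\<in>G. ((if p = q then 1 else 0) - \<beta>) * f p) = f q - \<beta> * sum f G"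
proof -
  have "(\<Sum>p\<in>G. ((if p = q then 1 else 0) - \<beta>) * f p) = (\<Sum>p\<in>G. (if p = q then f p else 0) - \<beta> * f p)"
    by (intro sum.cong) (auto simp: algebra_simps)
  then show ?thesis using assms by (simp add: sum_subtractf sum_distrib_left)
qed

lemma matrix_vector_mult_block_diagonal:
  fixes M :: "real^'n^'n" and blk :: "'n \<Rightarrow> nat"
  assumes "\<And>p q. blk p \<noteq> blk q \<Longrightarrow> M $ p $ q = 0"
  shows "(M *v x) $ p = (\<Sum>q | blk q = blk p. M $ p $ q * x $ q)"
proof -
  have "(M *v x) $ p = (\<Sum>q\<in>UNIV. if blk q = blk p then M $ p $ q * x $ q else 0)"
    unfolding matrix_vector_mult_def vec_lambda_beta using assms by (intro sum.cong) auto
  then show ?thesis by (simp add: sum.If_cases)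
qed

lemma vector_matrix_mult_block_diagonal:
  fixes M :: "real^'n^'n" and blk :: "'n \<Rightarrow> nat"
  assumes "\<And>p q. blk p \<noteq> blk q \<Longrightarrow> M $ p $ q = 0"
  shows "(x v* M) $ q = (\<Sum>p | blk p = blk q. x $ p * M $ p $ q)"
proof -
  have "(x v* M) $ q = (\<Sum>p\<in>UNIV. if blk p = blk q then x $ p * M $ p $ q else 0)"
    unfolding vector_matrix_mult_def vec_lambda_beta using assms
    by (intro sum.cong) (auto simp: mult.commute)
  then show ?thesis by (simp add: sum.If_cases)
qed

lemma block_matrix_off_block: "blk p \<noteq> blk q \<Longrightarrow> block_matrix blk c \<eta> $ p $ q = 0"
  by (simp add: block_matrix_def)

text \<open>On a block of size b, (I - \<beta> J)\<inverse> = I + \<gamma> J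
  for \<beta> = (1 - \<eta>) / b and \<gamma> = (1 - \<eta>) / (\<eta> b).\<close>
lemma block_inverse_coeff:
  fixes \<eta> b :: real
  assumes "0 < \<eta>" and "0 < b"
  shows "(1 - \<eta>) / (\<eta> * b) - (1 - \<eta>) / b * (1 + b * ((1 - \<eta>) / (\<eta> * b))) = 0"
  using assms by (simp add: field_simps)

lemma dual_vector_mult_block_matrix:
  assumes "blk l \<noteq> 0" and "0 < \<eta>"
  shows "dual_vector blk \<eta> l v* block_matrix blk c \<eta> = axis l (c (blk l))"
  unfolding vec_eq_iff
proof
  fix q
  let ?\<nu> = "dual_vector blk \<eta> l" and ?M = "block_matrix blk c \<eta>"
  show "(?\<nu> v* ?M) $ q = axis l (c (blk l)) $ q"
  proof (cases "blk q = blk l")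
    case False
    then have vanish: "?\<nu> $ p * ?M $ p $ q = 0" for p
      by (auto simp: dual_vector_def block_matrix_def)
    have "(?\<nu> v* ?M) $ q = 0"
      unfolding vector_matrix_mult_def vec_lambda_beta by (simp only: vanish sum.neutral_const)
    with False show ?thesis by (auto simp: axis_def)
  next
    case True
    define G where "G = {p. blk p = blk l}"
    define b where "b = real (block_size blk (blk l))"
    define \<beta> where "\<beta> = (1 - \<eta>) / b"
    define \<gamma> where "\<gamma> = (1 - \<eta>) / (\<eta> * b)"
    have b: "0 < b" "real (card G) = b"
      using block_size_pos[of blk l] by (simp_all add: b_def G_def block_size_def)
    have "(?\<nu> v* ?M) $ q = (\<Sum>p | blk p = blk q. ?\<nu> $ p * ?M $ p $ q)"
      by (rule vector_matrix_mult_block_diagonal) (rule block_matrix_off_block)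
    also have "\<dots> = (\<Sum>p\<in>G. ((if p = q then 1 else 0) - \<beta>) * (c (blk l) * ?\<nu> $ p))"
      using True assms(1)
      by (intro sum.cong) (auto simp: G_def block_matrix_def \<beta>_def b_def)
    also have "\<dots> = c (blk l) * (?\<nu> $ q - \<beta> * (\<Sum>p\<in>G. ?\<nu> $ p))"
      using True by (subst sum_delta_minus_const) (auto simp: G_def sum_distrib_left algebra_simps)
    also have "(\<Sum>p\<in>G. ?\<nu> $ p) = 1 + b * \<gamma>"
      using b by (simp add: dual_vector_def sum.distrib G_def \<gamma>_def b_def)
    also have "?\<nu> $ q = (if q = l then 1 else 0) + \<gamma>"
      using True by (simp add: dual_vector_def \<gamma>_def b_def)
    also have "(if q = l then 1 else 0) + \<gamma> - \<beta> * (1 + b * \<gamma>) = (if q = l then 1 else 0)"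
      using block_inverse_coeff[OF assms(2) b(1)] unfolding \<beta>_def \<gamma>_def by linarith
    also have "c (blk l) * (if q = l then 1 else 0) = axis l (c (blk l)) $ q"
      by (simp add: axis_def)
    finally show ?thesis .
  qed
qed

lemma inner_dual_vector_self:
  fixes blk :: "'n::finite \<Rightarrow> nat" and l :: 'n
  assumes "0 < \<eta>"
  defines "b \<equiv> real (block_size blk (blk l))"
  shows "dual_vector blk \<eta> l \<bullet> dual_vector blk \<eta> l = (1 + \<eta>\<^sup>2 * (b - 1)) / (\<eta>\<^sup>2 * b)"
proof -
  define \<gamma> where "\<gamma> = (1 - \<eta>) / (\<eta> * b)"
  have "dual_vector blk \<eta> l $ p * dual_vector blk \<eta> l $ p =
      (if blk p = blk l then \<gamma>\<^sup>2 else 0) + (if p = l then 1 + 2 * \<gamma> else 0)" for p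
    by (auto simp: dual_vector_def \<gamma>_def b_def power2_eq_square algebra_simps)
  then have "dual_vector blk \<eta> l \<bullet> dual_vector blk \<eta> l = b * \<gamma>\<^sup>2 + (1 + 2 * \<gamma>)"
    by (simp add: inner_vec_def sum.distrib sum.If_cases b_def block_size_def)
  also have "\<dots> = (1 + \<eta>\<^sup>2 * (b - 1)) / (\<eta>\<^sup>2 * b)"
    using block_size_pos[of blk l] assms(1)
    by (simp add: \<gamma>_def b_def field_simps power2_eq_square)
  finally show ?thesis .
qed

lemma Er_embed_block_matrix_ge:
  fixes blk :: "'n::finite \<Rightarrow> nat" and \<iota> :: "'n \<Rightarrow> 'm::finite"
  assumes "inj \<iota>" and "0 < \<eta>" and "blk l \<noteq> 0" and "l \<notin> S"
  defines "b \<equiv> real (block_size blk (blk l))"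
  shows "(c (blk l))\<^sup>2 * (\<eta>\<^sup>2 * b) \<le> (1 + \<eta>\<^sup>2 * (b - 1)) * Er (embed_rows \<iota> (block_matrix blk c \<eta>)) S"
proof -
  let ?A = "embed_rows \<iota> (block_matrix blk c \<eta>)"
  define \<nu> where "\<nu> = embed_vec \<iota> (dual_vector blk \<eta> l)"
  have col: "\<nu> \<bullet> column j ?A = axis l (c (blk l)) $ j" for j
    unfolding \<nu>_def column_embed_rows inner_embed_vec[OF assms(1)]
    by (simp only: vector_matrix_mult_component[symmetric]
        dual_vector_mult_block_matrix[of blk l \<eta> c, OF assms(3,2)])
  have "(\<nu> \<bullet> column l ?A)\<^sup>2 \<le> (\<nu> \<bullet> \<nu>) * Er ?A S"
    by (rule Er_ge_inner_column) (use col assms(4) in \<open>auto simp: axis_def\<close>)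
  moreover have "\<nu> \<bullet> \<nu> = (1 + \<eta>\<^sup>2 * (b - 1)) / (\<eta>\<^sup>2 * b)"
    unfolding \<nu>_def inner_embed_vec[OF assms(1)] b_def by (rule inner_dual_vector_self[OF assms(2)])
  moreover have "0 < \<eta>\<^sup>2 * b"
    using assms(2) block_size_pos[of blk l] by (simp add: b_def)
  ultimately show ?thesis
    using col[of l] by (simp add: pos_le_divide_eq mult.commute mult.left_commute)
qed

text \<open>The dual vectors recover each coordinate of z inside the blocks from A z.\<close>
lemma inner_self_le_block_matrix:
  fixes blk :: "'n::finite \<Rightarrow> nat"
  assumes "0 < \<eta>" and "\<And>j. 0 < c j" and "\<And>p. blk p = 0 \<Longrightarrow> z $ p = 0"
  defines "Az \<equiv> block_matrix blk c \<eta> *v z"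
  shows "z \<bullet> z \<le> (\<Sum>l | blk l \<noteq> 0. (dual_vector blk \<eta> l \<bullet> dual_vector blk \<eta> l) / (c (blk l))\<^sup>2)
      * (Az \<bullet> Az)"
proof -
  have coord: "(z $ l)\<^sup>2 \<le> (dual_vector blk \<eta> l \<bullet> dual_vector blk \<eta> l) / (c (blk l))\<^sup>2 * (Az \<bullet> Az)"
    if "blk l \<noteq> 0" for l
  proof -
    have "dual_vector blk \<eta> l \<bullet> Az = c (blk l) * z $ l"
      unfolding Az_def dot_lmul_matrix[symmetric]
        dual_vector_mult_block_matrix[of blk l \<eta> c, OF that assms(1)]
      by (simp add: inner_axis')
    then have "(c (blk l) * z $ l)\<^sup>2 \<le> (dual_vector blk \<eta> l \<bullet> dual_vector blk \<eta> l) * (Az \<bullet> Az)"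
      by (metis Cauchy_Schwarz_ineq)
    then show ?thesis
      using assms(2)[of "blk l"] by (simp add: field_simps power_mult_distrib)
  qed
  have "z \<bullet> z = (\<Sum>l | blk l \<noteq> 0. (z $ l)\<^sup>2)"
    unfolding inner_vec_def inner_real_def power2_eq_square
    by (rule sum.mono_neutral_right) (use assms(3) in auto)
  also have "\<dots> \<le> (\<Sum>l | blk l \<noteq> 0. (dual_vector blk \<eta> l \<bullet> dual_vector blk \<eta> l) / (c (blk l))\<^sup>2 * (Az \<bullet> Az))"
    by (rule sum_mono) (use coord in auto)
  finally show ?thesis by (simp add: sum_distrib_right)
qed

lemma OPT_embed_block_matrix_pos:
  fixes blk :: "'n::finite \<Rightarrow> nat" and \<iota> :: "'n \<Rightarrow> 'm::finite" and B\<^sub>0 :: "real^'n^'m"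
  assumes "inj \<iota>" and "0 < \<eta>" and "\<And>j. 0 < c j"
    and "k < card {p. blk p \<noteq> 0}" and "rank B\<^sub>0 = k"
  shows "0 < OPT (embed_rows \<iota> (block_matrix blk c \<eta>)) k"
proof -
  let ?A = "embed_rows \<iota> (block_matrix blk c \<eta>)"
  define G where "G = {p. blk p \<noteq> 0}"
  define Y where "Y = {z::real^'n. \<forall>p. p \<notin> G \<longrightarrow> z $ p = 0}"
  define K where "K = (\<Sum>l | blk l \<noteq> 0. (dual_vector blk \<eta> l \<bullet> dual_vector blk \<eta> l) / (c (blk l))\<^sup>2)"
  have Y: "subspace Y" unfolding Y_def subspace_def by auto
  have "vec.dim Y = card G"
    unfolding Y_def by (rule dim_substandard_cart)
  then have "dim Y = card G" by (simp add: dim_vec_eq)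
  then have rank_lt: "k < dim Y" using assms(4) by (simp add: G_def)
  have "z \<bullet> z \<le> K * ((?A *v z) \<bullet> (?A *v z))" if "z \<in> Y" for z
    unfolding K_def embed_rows_mult inner_embed_vec[OF assms(1)]
    by (rule inner_self_le_block_matrix[OF assms(2,3)]) (use that in \<open>auto simp: Y_def G_def\<close>)
  then have bound: "1 \<le> K * frob_sq (?A - B)" if "rank B = k" for B :: "real^'n^'m"
    using frob_sq_diff_ge_of_rank_lt[OF Y] rank_lt that by auto
  have "0 \<le> K" unfolding K_def by (intro sum_nonneg divide_nonneg_nonneg) auto
  with bound[OF assms(5)] have K: "0 < K"
    by (cases "K = 0") auto
  have "1 / K \<le> OPT ?A k"
    using bound K by (intro OPT_ge[OF assms(5)]) (simp add: divide_le_eq mult.commute)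
  then show ?thesis using K by (meson divide_pos_pos order_less_le_trans zero_less_one)
qed

section \<open>The truncated block matrix\<close>

text \<open>Blocks before i are kept, block i loses its constant direction (singular value c_i \<eta>),
  and later blocks are dropped: the best approximation of rank |G_1 u ... u G_i| - 1.\<close>
definition block_matrix_trunc :: "('n::finite \<Rightarrow> nat) \<Rightarrow> (nat \<Rightarrow> real) \<Rightarrow> real \<Rightarrow> nat \<Rightarrow> real^'n^'n" where
  "block_matrix_trunc blk c \<eta> i = (\<chi> p q. if blk p = blk q \<and> blk p \<noteq> 0 \<and> blk p \<le> i
      then c (blk p) * ((if p = q then 1 else 0)
        - (if blk p = i then 1 else 1 - \<eta>) / real (block_size blk (blk p))) else 0)"

lemma abs_block_matrix_le:
  assumes "0 \<le> \<eta>" and "\<eta> \<le> 1" and "0 \<le> c (blk p)"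
  shows "\<bar>block_matrix blk c \<eta> $ p $ q\<bar> \<le> c (blk p)"
proof -
  define \<beta> where "\<beta> = (1 - \<eta>) / real (block_size blk (blk p))"
  have "0 \<le> \<beta>" "\<beta> \<le> 1"
    using assms(1,2) block_size_pos[of blk p] by (auto simp: \<beta>_def field_simps)
  then have "\<bar>(if p = q then 1 else 0) - \<beta>\<bar> \<le> 1" by auto
  then have bound: "\<bar>c (blk p) * ((if p = q then 1 else 0) - \<beta>)\<bar> \<le> c (blk p)"
    using assms(3) by (simp add: abs_mult mult_left_le)
  have entry: "block_matrix blk c \<eta> $ p $ q = (if blk p = blk q \<and> blk p \<noteq> 0
      then c (blk p) * ((if p = q then 1 else 0) - \<beta>) else 0)"
    by (simp add: block_matrix_def \<beta>_def)
  show ?thesis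
  proof (cases "blk p = blk q \<and> blk p \<noteq> 0")
    case True
    show ?thesis unfolding entry if_P[OF True] by (rule bound)
  next
    case False
    then show ?thesis unfolding entry if_not_P[OF False] using assms(3) by simp
  qed
qed

lemma block_matrix_diff_trunc_entry:
  assumes "i \<noteq> 0"
  shows "(block_matrix blk c \<eta> - block_matrix_trunc blk c \<eta> i) $ p $ q =
    (if blk p = i \<and> blk q = i then c i * \<eta> / real (block_size blk i)
     else if blk p = blk q \<and> i < blk p then block_matrix blk c \<eta> $ p $ q else 0)"
proof -
  consider "blk p = i \<and> blk q = i" | "blk p = blk q \<and> i < blk p"
    | "\<not> (blk p = i \<and> blk q = i)" "\<not> (blk p = blk q \<and> i < blk p)"
    by blast
  then show ?thesis
  proof cases
    case 1
    have "0 < real (block_size blk i)" using block_size_pos[of blk p] 1 by simp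
    then show ?thesis
      using 1 assms by (simp add: block_matrix_def block_matrix_trunc_def field_simps)
  qed (auto simp: block_matrix_def block_matrix_trunc_def)
qed

lemma block_matrix_diff_trunc_entry_sq_le:
  assumes "0 \<le> \<eta>" and "\<eta> \<le> 1" and "\<And>j. 0 \<le> c j" and "\<And>j. i < j \<Longrightarrow> c j \<le> c (Suc i)"
    and "i \<noteq> 0"
  shows "((block_matrix blk c \<eta> - block_matrix_trunc blk c \<eta> i) $ p $ q)\<^sup>2
    \<le> (if blk p = i \<and> blk q = i then (c i * \<eta> / real (block_size blk i))\<^sup>2 else 0) + (c (Suc i))\<^sup>2"
proof -
  consider "blk p = i \<and> blk q = i" | "\<not> (blk p = i \<and> blk q = i)" "blk p = blk q \<and> i < blk p"
    | "\<not> (blk p = i \<and> blk q = i)" "\<not> (blk p = blk q \<and> i < blk p)"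
    by blast
  then show ?thesis
  proof cases
    case 1
    then show ?thesis unfolding block_matrix_diff_trunc_entry[OF assms(5)] by simp
  next
    case 2
    have "c (blk p) \<le> c (Suc i)" using assms(4) 2(2) by blast
    then have "\<bar>block_matrix blk c \<eta> $ p $ q\<bar> \<le> c (Suc i)"
      using abs_block_matrix_le[of \<eta> c blk p q, OF assms(1,2) assms(3)] by linarith
    then have "(block_matrix blk c \<eta> $ p $ q)\<^sup>2 \<le> (c (Suc i))\<^sup>2"
      by (metis abs_ge_zero power2_abs power_mono)
    then show ?thesis using 2 unfolding block_matrix_diff_trunc_entry[OF assms(5)] by simp
  next
    case 3
    then show ?thesis unfolding block_matrix_diff_trunc_entry[OF assms(5)] by auto
  qed
qed

lemma frob_sq_block_matrix_diff_trunc: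
  fixes blk :: "'n::finite \<Rightarrow> nat"
  assumes "0 \<le> \<eta>" and "\<eta> \<le> 1" and "\<And>j. 0 \<le> c j" and "\<And>j. i < j \<Longrightarrow> c j \<le> c (Suc i)"
    and "i \<noteq> 0"
  shows "frob_sq (block_matrix blk c \<eta> - block_matrix_trunc blk c \<eta> i)
    \<le> (c i * \<eta>)\<^sup>2 + (real CARD('n))\<^sup>2 * (c (Suc i))\<^sup>2"
proof -
  define b where "b = real (block_size blk i)"
  define f where "f p q = (if blk p = i \<and> blk q = i then (c i * \<eta> / b)\<^sup>2 else 0)" for p q :: 'n
  have "frob_sq (block_matrix blk c \<eta> - block_matrix_trunc blk c \<eta> i)
      \<le> (\<Sum>p\<in>UNIV. \<Sum>q\<in>UNIV. f p q + (c (Suc i))\<^sup>2)"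
    unfolding frob_sq_def f_def b_def
    by (intro sum_mono block_matrix_diff_trunc_entry_sq_le[where c = c, OF assms])
  also have "\<dots> = (\<Sum>p\<in>UNIV. \<Sum>q\<in>UNIV. f p q) + (real CARD('n))\<^sup>2 * (c (Suc i))\<^sup>2"
    by (simp add: sum.distrib power2_eq_square)
  also have "(\<Sum>p\<in>UNIV. \<Sum>q\<in>UNIV. f p q) = b * b * (c i * \<eta> / b)\<^sup>2"
  proof -
    have "(\<Sum>q\<in>UNIV. f p q) = (if blk p = i then b * (c i * \<eta> / b)\<^sup>2 else 0)" for p
      unfolding f_def b_def block_size_def by (simp add: sum.If_cases)
    then show ?thesis unfolding b_def block_size_def by (simp add: sum.If_cases)
  qed
  also have "b * b * (c i * \<eta> / b)\<^sup>2 \<le> (c i * \<eta>)\<^sup>2"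
    by (cases "b = 0") (simp_all add: power_divide power2_eq_square[of b])
  finally show ?thesis by simp
qed

lemma block_matrix_trunc_mult:
  fixes blk :: "'n::finite \<Rightarrow> nat" and p :: 'n and i :: nat and \<eta> :: real
  defines "\<beta> \<equiv> (if blk p = i then 1 else 1 - \<eta>) / real (block_size blk (blk p))"
  shows "(block_matrix_trunc blk c \<eta> i *v x) $ p =
    (if blk p \<noteq> 0 \<and> blk p \<le> i then c (blk p) * (x $ p - \<beta> * (\<Sum>q | blk q = blk p. x $ q)) else 0)"
proof -
  have "(block_matrix_trunc blk c \<eta> i *v x) $ p =
      (\<Sum>q | blk q = blk p. block_matrix_trunc blk c \<eta> i $ p $ q * x $ q)"
    by (rule matrix_vector_mult_block_diagonal) (simp add: block_matrix_trunc_def)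
  also have "\<dots> = (if blk p \<noteq> 0 \<and> blk p \<le> i
      then (\<Sum>q | blk q = blk p. ((if q = p then 1 else 0) - \<beta>) * (c (blk p) * x $ q)) else 0)"
    by (auto simp: block_matrix_trunc_def \<beta>_def intro: sum.cong)
  also have "(\<Sum>q | blk q = blk p. ((if q = p then 1 else 0) - \<beta>) * (c (blk p) * x $ q))
      = c (blk p) * x $ p - \<beta> * (\<Sum>q | blk q = blk p. c (blk p) * x $ q)"
    by (rule sum_delta_minus_const) auto
  also have "(\<Sum>q | blk q = blk p. c (blk p) * x $ q) = c (blk p) * (\<Sum>q | blk q = blk p. x $ q)"
    by (rule sum_distrib_left[symmetric])
  finally show ?thesis
    by (simp add: algebra_simps)
qed

definition zero_sum_space :: "'n set \<Rightarrow> 'n set \<Rightarrow> (real^'n) set" where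
  "zero_sum_space H G = {x. (\<forall>p. p \<notin> H \<longrightarrow> x $ p = 0) \<and> (\<Sum>p\<in>G. x $ p) = 0}"

lemma dim_zero_sum_space:
  fixes H G :: "'n::finite set"
  assumes "G \<subseteq> H" and "p\<^sub>0 \<in> G"
  shows "dim (zero_sum_space H G) = card H - 1"
proof -
  define Y where "Y = {x::real^'n. \<forall>p. p \<notin> H \<longrightarrow> x $ p = 0}"
  define U where "U = zero_sum_space H G"
  define e where "e = (axis p\<^sub>0 1 :: real^'n)"
  have U: "subspace U"
    unfolding U_def zero_sum_space_def subspace_def by (auto simp: sum.distrib sum_distrib_left[symmetric])
  have "vec.dim Y = card H" unfolding Y_def by (rule dim_substandard_cart)
  then have dimY: "dim Y = card H" by (simp add: dim_vec_eq)
  have e: "e \<in> Y" "e \<notin> U"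
    using assms by (auto simp: Y_def U_def zero_sum_space_def e_def axis_def)
  have "U \<subseteq> Y" by (auto simp: U_def zero_sum_space_def Y_def)
  then have "dim (insert e U) \<le> dim Y" using e(1) by (intro dim_subset) auto
  moreover have "Y \<subseteq> span (insert e U)"
  proof
    fix y assume y: "y \<in> Y"
    define s where "s = (\<Sum>p\<in>G. y $ p)"
    have "(\<Sum>p\<in>G. e $ p) = 1" using assms(2) by (simp add: e_def axis_def)
    then have "(\<Sum>p\<in>G. (y - s *\<^sub>R e) $ p) = 0"
      by (simp add: sum_subtractf sum_distrib_left[symmetric] s_def)
    moreover have "(y - s *\<^sub>R e) $ p = 0" if "p \<notin> H" for p
      using y that assms by (auto simp: Y_def e_def axis_def)
    ultimately have "y - s *\<^sub>R e \<in> U" by (simp add: U_def zero_sum_space_def)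
    then have "s *\<^sub>R e + (y - s *\<^sub>R e) \<in> span (insert e U)"
      by (intro span_add span_mul span_base) (auto intro: span_base)
    then show "y \<in> span (insert e U)" by simp
  qed
  then have "dim Y \<le> dim (span (insert e U))" by (rule dim_subset)
  then have "dim Y \<le> dim (insert e U)" by (simp only: dim_span)
  moreover have "dim (insert e U) = dim U + 1"
    using e(2) U by (simp add: dim_insert span_eq_iff[THEN iffD2])
  ultimately show ?thesis using dimY by (simp add: U_def)
qed

lemma block_matrix_trunc_mult_in_zero_sum_space:
  fixes blk :: "'n::finite \<Rightarrow> nat"
  assumes "i \<noteq> 0"
  shows "block_matrix_trunc blk c \<eta> i *v x \<in> zero_sum_space {p. blk p \<noteq> 0 \<and> blk p \<le> i} {p. blk p = i}"
proof -
  define G where "G = {p. blk p = i}"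
  define s where "s = (\<Sum>q\<in>G. x $ q)"
  define b where "b = real (card G)"
  have "(\<Sum>p\<in>G. (block_matrix_trunc blk c \<eta> i *v x) $ p) = (\<Sum>p\<in>G. c i * (x $ p - s / b))"
    using assms by (intro sum.cong) (auto simp: block_matrix_trunc_mult G_def s_def b_def block_size_def)
  also have "\<dots> = c i * (s - b * (s / b))"
    by (simp add: sum_distrib_left[symmetric] sum_subtractf s_def b_def)
  also have "\<dots> = 0"
    by (cases "b = 0") (simp_all add: s_def b_def)
  finally show ?thesis by (simp add: zero_sum_space_def block_matrix_trunc_mult G_def)
qed

text \<open>The earlier blocks are inverted by block_inverse_coeff; on block i, x / c_i is a preimage
  because x sums to zero there.\<close>
lemma zero_sum_space_subset_range_block_matrix_trunc:
  fixes blk :: "'n::finite \<Rightarrow> nat"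
  assumes "0 < \<eta>" and "\<And>j. 0 < c j"
  shows "zero_sum_space {p. blk p \<noteq> 0 \<and> blk p \<le> i} {p. blk p = i}
    \<subseteq> range ((*v) (block_matrix_trunc blk c \<eta> i))"
proof
  fix x assume "x \<in> zero_sum_space {p. blk p \<noteq> 0 \<and> blk p \<le> i} {p. blk p = i}"
  then have x: "\<And>p. \<not> (blk p \<noteq> 0 \<and> blk p \<le> i) \<Longrightarrow> x $ p = 0" "(\<Sum>p | blk p = i. x $ p) = 0"
    by (auto simp: zero_sum_space_def)
  define \<gamma> where "\<gamma> j = (if j = i then 0 else (1 - \<eta>) / (\<eta> * real (block_size blk j)))" for j
  define y where "y = (\<chi> q. if blk q \<noteq> 0 \<and> blk q \<le> i
      then (x $ q + \<gamma> (blk q) * (\<Sum>r | blk r = blk q. x $ r)) / c (blk q) else 0)"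
  have "(block_matrix_trunc blk c \<eta> i *v y) $ p = x $ p" for p
  proof (cases "blk p \<noteq> 0 \<and> blk p \<le> i")
    case False
    then show ?thesis
      unfolding block_matrix_trunc_mult if_not_P[OF False] using x(1)[OF False] by simp
  next
    case True
    define j where "j = blk p"
    define s where "s = (\<Sum>r | blk r = j. x $ r)"
    define b where "b = real (block_size blk j)"
    define \<beta> where "\<beta> = (if j = i then 1 else 1 - \<eta>) / b"
    have b: "0 < b" using block_size_pos[of blk p] by (simp add: b_def j_def)
    have y: "y $ q = (x $ q + \<gamma> j * s) / c j" if "blk q = j" for q
      using True that by (simp add: y_def j_def s_def)
    then have sum_y: "(\<Sum>q | blk q = j. y $ q) = (s + b * (\<gamma> j * s)) / c j"
      by (simp add: sum_divide_distrib[symmetric] sum.distrib s_def b_def block_size_def)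
    have "(block_matrix_trunc blk c \<eta> i *v y) $ p = c j * (y $ p - \<beta> * (\<Sum>q | blk q = j. y $ q))"
      using True by (simp add: block_matrix_trunc_mult j_def \<beta>_def b_def)
    also have "\<dots> = c j * ((x $ p + \<gamma> j * s) / c j - \<beta> * ((s + b * (\<gamma> j * s)) / c j))"
      by (simp only: y[OF j_def[symmetric]] sum_y)
    also have "\<dots> = x $ p + s * (\<gamma> j - \<beta> * (1 + b * \<gamma> j))"
      using assms(2)[of j] by (simp add: field_simps)
    also have "s * (\<gamma> j - \<beta> * (1 + b * \<gamma> j)) = 0"
    proof (cases "j = i")
      case True
      then show ?thesis using x(2) by (simp add: s_def)
    next
      case False
      then have \<gamma>: "\<gamma> j = (1 - \<eta>) / (\<eta> * b)" and \<beta>: "\<beta> = (1 - \<eta>) / b"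
        by (simp_all add: \<gamma>_def \<beta>_def b_def)
      have "\<gamma> j - \<beta> * (1 + b * \<gamma> j) = 0"
        unfolding \<gamma> \<beta> by (rule block_inverse_coeff[OF assms(1) b])
      then show ?thesis by simp
    qed
    finally show ?thesis by simp
  qed
  then have "block_matrix_trunc blk c \<eta> i *v y = x" by (simp add: vec_eq_iff)
  then show "x \<in> range ((*v) (block_matrix_trunc blk c \<eta> i))" by (metis rangeI)
qed

lemma range_block_matrix_trunc:
  fixes blk :: "'n::finite \<Rightarrow> nat"
  assumes "0 < \<eta>" and "\<And>j. 0 < c j" and "i \<noteq> 0"
  shows "range ((*v) (block_matrix_trunc blk c \<eta> i))
    = zero_sum_space {p. blk p \<noteq> 0 \<and> blk p \<le> i} {p. blk p = i}"
  using block_matrix_trunc_mult_in_zero_sum_space[OF assms(3), of blk c \<eta>]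
    zero_sum_space_subset_range_block_matrix_trunc[of \<eta> c blk i, OF assms(1,2)]
  by blast

lemma rank_block_matrix_trunc:
  fixes blk :: "'n::finite \<Rightarrow> nat"
  assumes "0 < \<eta>" and "\<And>j. 0 < c j" and "i \<noteq> 0" and "blk p\<^sub>0 = i"
  shows "rank (block_matrix_trunc blk c \<eta> i) = card {p. blk p \<noteq> 0 \<and> blk p \<le> i} - 1"
  unfolding rank_dim_range range_block_matrix_trunc[OF assms(1-3)]
  by (rule dim_zero_sum_space) (use assms(3,4) in auto)

lemma rank_embed_block_matrix_trunc:
  fixes blk :: "'n::finite \<Rightarrow> nat" and \<iota> :: "'n \<Rightarrow> 'm::finite"
  assumes "inj \<iota>" and "0 < \<eta>" and "\<And>j. 0 < c j" and "i \<noteq> 0" and "blk p\<^sub>0 = i"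
    and "card {p. blk p \<noteq> 0 \<and> blk p \<le> i} = Suc k"
  shows "rank (embed_rows \<iota> (block_matrix_trunc blk c \<eta> i)) = k"
  unfolding rank_embed_rows[OF assms(1)] rank_block_matrix_trunc[of \<eta> c i blk p\<^sub>0, OF assms(2-5)]
  using assms(6) by simp

lemma OPT_embed_block_matrix_le:
  fixes blk :: "'n::finite \<Rightarrow> nat" and \<iota> :: "'n \<Rightarrow> 'm::finite"
  assumes "inj \<iota>" and "0 < \<eta>" and "\<eta> \<le> 1" and "\<And>j. 0 < c j" and "\<And>j. i < j \<Longrightarrow> c j \<le> c (Suc i)"
    and "i \<noteq> 0" and "blk p\<^sub>0 = i" and "card {p. blk p \<noteq> 0 \<and> blk p \<le> i} = Suc k"
  shows "OPT (embed_rows \<iota> (block_matrix blk c \<eta>)) k \<le> (c i * \<eta>)\<^sup>2 + (real CARD('n))\<^sup>2 * (c (Suc i))\<^sup>2"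
proof -
  have "frob_sq (embed_rows \<iota> (block_matrix blk c \<eta>) - embed_rows \<iota> (block_matrix_trunc blk c \<eta> i))
      \<le> (c i * \<eta>)\<^sup>2 + (real CARD('n))\<^sup>2 * (c (Suc i))\<^sup>2"
    unfolding embed_rows_diff frob_sq_embed_rows[OF assms(1)]
    by (rule frob_sq_block_matrix_diff_trunc) (use assms(2-6) less_imp_le in auto)
  then show ?thesis
    using OPT_le[OF rank_embed_block_matrix_trunc[of \<iota> \<eta> c i blk p\<^sub>0 k, OF assms(1,2,4,6-8)],
        of "embed_rows \<iota> (block_matrix blk c \<eta>)"]
    by linarith
qed

section \<open>The hard instance\<close>

lemma ratio_ge_of_bounds:
  fixes X D err opt \<delta> :: real
  assumes "0 < opt" and "opt \<le> X * (1 + \<delta> / 4)" and "X * D \<le> (1 + \<delta> / 4) * err"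
    and "0 < \<delta>" and "\<delta> < 1" and "0 \<le> err"
  shows "(1 - \<delta>) * D \<le> err / opt"
proof (cases "D \<le> 0")
  case True
  then have "(1 - \<delta>) * D \<le> 0" using assms(5) by (simp add: mult_nonneg_nonpos)
  also have "0 \<le> err / opt" using assms(1,6) by simp
  finally show ?thesis .
next
  case False
  have "\<delta> * \<delta> \<le> \<delta>" using assms(4,5) mult_left_le[of \<delta> \<delta>] by auto
  moreover have "(1 + \<delta> / 4) * (1 + \<delta> / 4) = 1 + \<delta> / 2 + \<delta> * \<delta> / 16"
    by (simp add: algebra_simps)
  ultimately have "(1 + \<delta> / 4) * (1 + \<delta> / 4) \<le> 1 + \<delta>"
    using assms(4) by linarith
  then have "(1 - \<delta>) * ((1 + \<delta> / 4) * (1 + \<delta> / 4)) \<le> (1 - \<delta>) * (1 + \<delta>)"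
    using assms(5) by (intro mult_left_mono) auto
  also have "\<dots> \<le> 1" by (simp add: algebra_simps)
  finally have key: "(1 - \<delta>) * (1 + \<delta> / 4) * (1 + \<delta> / 4) \<le> 1" by (simp add: mult.assoc)
  have "(1 - \<delta>) * D * opt \<le> (1 - \<delta>) * D * (X * (1 + \<delta> / 4))"
    using assms(2,5) False by (intro mult_left_mono) auto
  also have "\<dots> = (1 - \<delta>) * (1 + \<delta> / 4) * (X * D)" by (simp add: algebra_simps)
  also have "\<dots> \<le> (1 - \<delta>) * (1 + \<delta> / 4) * ((1 + \<delta> / 4) * err)"
    using assms(3,4,5) by (intro mult_left_mono) auto
  also have "\<dots> \<le> err"
    using mult_right_mono[OF key assms(6)] by (simp add: mult.assoc)
  finally show ?thesis using assms(1) by (simp add: le_divide_eq)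
qed

lemma delta_div_2n_bounds:
  fixes \<delta> n :: real
  assumes "0 < \<delta>" and "\<delta> < 1" and "1 \<le> n"
  shows "0 < \<delta> / (2 * n)" and "\<delta> / (2 * n) \<le> 1 / 2" and "n * (\<delta> / (2 * n)) = \<delta> / 2"
    and "(\<delta> / (2 * n))\<^sup>2 * n \<le> \<delta> / 4"
proof -
  have "\<delta> \<le> n" using assms by linarith
  then show "0 < \<delta> / (2 * n)" and "\<delta> / (2 * n) \<le> 1 / 2" and "n * (\<delta> / (2 * n)) = \<delta> / 2"
    using assms by (simp_all add: field_simps)
  have "(\<delta> / (2 * n))\<^sup>2 * n = \<delta> * (\<delta> / n) / 4"
    using assms(3) by (simp add: power2_eq_square field_simps)
  also have "\<delta> * (\<delta> / n) \<le> \<delta>"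
    using \<open>\<delta> \<le> n\<close> assms by (intro mult_left_le) simp_all
  finally show "(\<delta> / (2 * n))\<^sup>2 * n \<le> \<delta> / 4" by (simp add: divide_right_mono)
qed

lemma geometric_scale_le:
  fixes q D b n :: real
  assumes "0 \<le> q" and "q \<le> 1" and "0 \<le> n" and "q * q * n \<le> 1" and "j \<le> i" and "D \<le> n"
    and "j = i \<Longrightarrow> D \<le> b" and "1 \<le> b"
  shows "(q ^ i)\<^sup>2 * D \<le> (q ^ j)\<^sup>2 * b"
proof (cases "j = i")
  case True
  then show ?thesis using assms(7) by (simp add: mult_left_mono)
next
  case False
  have "q ^ i = q ^ j * q ^ (i - j)" using assms(5) by (simp flip: power_add)
  also have "\<dots> \<le> q ^ j * q"
    using False assms(1,2,5)
    by (intro mult_left_mono) (simp_all add: power_decreasing[of 1 "i - j" q, simplified])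
  finally have "(q ^ i)\<^sup>2 \<le> (q ^ j)\<^sup>2 * (q * q)"
    using assms(1) by (metis power_mono power_mult_distrib power2_eq_square zero_le_power)
  then have "(q ^ i)\<^sup>2 * n \<le> (q ^ j)\<^sup>2 * (q * q * n)"
    using assms(3) mult_right_mono by (fastforce simp: mult.assoc)
  moreover have "(q ^ i)\<^sup>2 * D \<le> (q ^ i)\<^sup>2 * n"
    using assms(6) by (simp add: mult_left_mono)
  moreover have "(q ^ j)\<^sup>2 * (q * q * n) \<le> (q ^ j)\<^sup>2 * b"
    using assms(4,8) by (intro mult_left_mono) auto
  ultimately show ?thesis by linarith
qed

lemma Er_embed_geometric_block_matrix_ge:
  fixes blk :: "'n::finite \<Rightarrow> nat" and \<iota> :: "'n \<Rightarrow> 'm::finite" and S :: "'n set"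
  assumes "inj \<iota>" and "0 < \<delta>" and "\<delta> < 1"
    and "card S < card {p. blk p \<noteq> 0 \<and> blk p \<le> i}" and "D \<le> real (block_size blk i)"
  defines "\<eta> \<equiv> \<delta> / (2 * real CARD('n))"
  shows "((\<eta>\<^sup>2) ^ i * \<eta>)\<^sup>2 * D \<le> (1 + \<delta> / 4) * Er (embed_rows \<iota> (block_matrix blk (\<lambda>j. (\<eta>\<^sup>2) ^ j) \<eta>)) S"
proof -
  let ?Er = "Er (embed_rows \<iota> (block_matrix blk (\<lambda>j. (\<eta>\<^sup>2) ^ j) \<eta>)) S"
  define n where "n = real CARD('n)"
  have n: "1 \<le> n" by (simp add: n_def)
  have \<eta>_n: "\<eta> = \<delta> / (2 * n)" by (simp add: \<eta>_def n_def)
  note \<eta> = delta_div_2n_bounds[OF assms(2,3) n, folded \<eta>_n]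
  have q: "0 \<le> \<eta>\<^sup>2" "\<eta>\<^sup>2 \<le> 1" using \<eta>(1,2) by (simp_all add: power_le_one)
  have "\<eta>\<^sup>2 * n \<le> 1" using \<eta>(4) assms(3) by linarith
  then have qqn: "\<eta>\<^sup>2 * \<eta>\<^sup>2 * n \<le> 1"
    using mult_le_one[OF q(2) _ \<open>\<eta>\<^sup>2 * n \<le> 1\<close>] n by (simp add: mult.assoc)
  obtain l where l: "blk l \<noteq> 0" "blk l \<le> i" "l \<notin> S"
    using assms(4) card_mono[of S "{p. blk p \<noteq> 0 \<and> blk p \<le> i}"] by (auto simp: subset_iff)
  define b where "b = real (block_size blk (blk l))"
  have b: "1 \<le> b" "b \<le> n"
    using block_size_pos[of blk l] block_size_le_card[of blk "blk l"] by (simp_all add: b_def n_def)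
  have "((\<eta>\<^sup>2) ^ i * \<eta>)\<^sup>2 * D = ((\<eta>\<^sup>2) ^ i)\<^sup>2 * D * \<eta>\<^sup>2" by (simp add: power_mult_distrib)
  also have "\<dots> \<le> ((\<eta>\<^sup>2) ^ blk l)\<^sup>2 * b * \<eta>\<^sup>2"
    using assms(5) block_size_le_card[of blk i] l(2) b(1) n
    by (intro mult_right_mono geometric_scale_le[OF q _ qqn]) (auto simp: b_def n_def)
  also have "\<dots> \<le> (1 + \<eta>\<^sup>2 * (b - 1)) * ?Er"
    using Er_embed_block_matrix_ge[of \<iota> \<eta> blk l S "\<lambda>j. (\<eta>\<^sup>2) ^ j", OF assms(1) \<eta>(1) l(1,3)]
    by (simp add: b_def mult_ac)
  also have "\<dots> \<le> (1 + \<delta> / 4) * ?Er"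
  proof (rule mult_right_mono)
    have "\<eta>\<^sup>2 * (b - 1) \<le> \<eta>\<^sup>2 * n" using b by (simp add: mult_left_mono)
    then show "1 + \<eta>\<^sup>2 * (b - 1) \<le> 1 + \<delta> / 4" using \<eta>(4) by simp
  qed (simp add: Er_def frob_sq_nonneg)
  finally show ?thesis .
qed

lemma ratio_embed_geometric_block_matrix_ge:
  fixes blk :: "'n::finite \<Rightarrow> nat" and \<iota> :: "'n \<Rightarrow> 'm::finite" and S :: "'n set"
  assumes "inj \<iota>" and "0 < \<delta>" and "\<delta> < 1" and "i \<noteq> 0"
    and "card {p. blk p \<noteq> 0 \<and> blk p \<le> i} = Suc k" and "k < card {p. blk p \<noteq> 0}" and "card S = k"
    and "0 < D" and "D \<le> real (block_size blk i)"
  defines "\<eta> \<equiv> \<delta> / (2 * real CARD('n))"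
  shows "(1 - \<delta>) * D \<le> Er (embed_rows \<iota> (block_matrix blk (\<lambda>j. (\<eta>\<^sup>2) ^ j) \<eta>)) S
    / OPT (embed_rows \<iota> (block_matrix blk (\<lambda>j. (\<eta>\<^sup>2) ^ j) \<eta>)) k"
proof -
  let ?c = "\<lambda>j. (\<eta>\<^sup>2) ^ j" and ?A = "embed_rows \<iota> (block_matrix blk (\<lambda>j. (\<eta>\<^sup>2) ^ j) \<eta>)"
  define n where "n = real CARD('n)"
  have n: "1 \<le> n" by (simp add: n_def)
  have \<eta>_n: "\<eta> = \<delta> / (2 * n)" by (simp add: \<eta>_def n_def)
  note \<eta> = delta_div_2n_bounds[OF assms(2,3) n, folded \<eta>_n]
  have \<eta>1: "\<eta> \<le> 1" using \<eta>(2) by simp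
  have c: "0 < ?c j" for j using \<eta>(1) by simp
  have c_mono: "?c j \<le> ?c (Suc i)" if "i < j" for j
    using that \<eta>(1) \<eta>1 by (intro power_decreasing) (simp_all add: power_le_one)
  obtain p\<^sub>0 where p\<^sub>0: "blk p\<^sub>0 = i"
    using assms(8,9) by (fastforce simp: block_size_def card_gt_0_iff)
  note rank = rank_embed_block_matrix_trunc[of \<iota> \<eta> ?c i blk p\<^sub>0 k, OF assms(1) \<eta>(1) c assms(4) p\<^sub>0 assms(5)]
  have "n\<^sup>2 * (?c (Suc i))\<^sup>2 = (?c i * \<eta>)\<^sup>2 * (n * \<eta>)\<^sup>2"
    by (simp add: power_mult_distrib power2_eq_square)
  also have "\<dots> \<le> (?c i * \<eta>)\<^sup>2 * (\<delta> / 4)"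
    using assms(2,3) by (intro mult_left_mono) (simp_all add: \<eta>(3) power2_eq_square mult_le_one)
  finally have "OPT ?A k \<le> (?c i * \<eta>)\<^sup>2 * (1 + \<delta> / 4)"
    using OPT_embed_block_matrix_le[of \<iota> \<eta> ?c i blk p\<^sub>0 k,
        OF assms(1) \<eta>(1) \<eta>1 c c_mono assms(4) p\<^sub>0 assms(5)]
    by (simp add: n_def algebra_simps)
  moreover have "0 < OPT ?A k"
    using OPT_embed_block_matrix_pos[OF assms(1) \<eta>(1) c assms(6) rank] .
  moreover have "(?c i * \<eta>)\<^sup>2 * D \<le> (1 + \<delta> / 4) * Er ?A S"
    using Er_embed_geometric_block_matrix_ge[OF assms(1,2,3) _ assms(9)] assms(5,7)
    by (simp add: \<eta>_def)
  ultimately show ?thesis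
    using ratio_ge_of_bounds assms(2,3) by (simp add: Er_def frob_sq_nonneg)
qed

lemma strict_mono_on_prefix:
  fixes k :: "nat \<Rightarrow> nat"
  assumes "\<forall>i<t. k i < k (Suc i)" and "a < b" and "b \<le> t"
  shows "k a < k b"
  using assms(2,3)
proof (induction b)
  case (Suc b)
  have "k b < k (Suc b)" using assms(1) Suc.prems(2) by simp
  then show ?case using Suc by (cases "a = b") auto
qed simp

lemma card_le_prefix:
  fixes pos :: "'n::finite \<Rightarrow> nat"
  assumes "bij_betw pos UNIV {0..<CARD('n)}" and "a < CARD('n)"
  shows "card {p. pos p \<le> a} = Suc a"
proof -
  have "pos ` {p. pos p \<le> a} = {0..a}"
    using assms by (force simp: bij_betw_def)
  moreover have "inj_on pos {p. pos p \<le> a}"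
    using assms(1) by (auto simp: bij_betw_def intro: inj_on_subset)
  ultimately show ?thesis by (metis card_atLeastAtMost card_image diff_zero)
qed

text \<open>Block j consists of the positions in (k (j - 1), k j], except that block 1 also contains
  position 0; so the blocks up to i have k i + 1 elements.\<close>
lemma ex_block_labels:
  fixes k :: "nat \<Rightarrow> nat"
  assumes "\<forall>i<t. k i < k (Suc i)" and "k t < CARD('n)"
  obtains blk :: "'n::finite \<Rightarrow> nat"
  where "\<And>i. 1 \<le> i \<Longrightarrow> i \<le> t \<Longrightarrow> card {p. blk p \<noteq> 0 \<and> blk p \<le> i} = Suc (k i)"
    and "\<And>p. blk p \<le> t"
proof -
  obtain pos :: "'n \<Rightarrow> nat" where pos: "bij_betw pos UNIV {0..<CARD('n)}"
    using ex_bij_betw_finite_nat[of "UNIV :: 'n set"] by auto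
  have mono: "k a \<le> k b" if "a \<le> b" "b \<le> t" for a b
    using strict_mono_on_prefix[OF assms(1), of a b] that by (cases "a = b") auto
  define P where "P p j \<longleftrightarrow> 1 \<le> j \<and> j \<le> t \<and> pos p \<le> k j" for p j
  define blk where "blk p = (if \<exists>j. P p j then LEAST j. P p j else 0)" for p
  have P_blk: "P p (blk p)" if "P p j" for p j
    using that LeastI[of "P p" j] by (auto simp: blk_def)
  have blk_le: "blk p \<le> j" if "P p j" for p j
    using that Least_le[of "P p" j] by (auto simp: blk_def)
  have "blk p \<noteq> 0 \<and> blk p \<le> i \<longleftrightarrow> pos p \<le> k i" if "1 \<le> i" "i \<le> t" for p i
  proof
    assume blk: "blk p \<noteq> 0 \<and> blk p \<le> i"
    then have "P p (blk p)" using P_blk by (metis blk_def)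
    then show "pos p \<le> k i" using mono[of "blk p" i] blk that by (simp add: P_def)
  next
    assume "pos p \<le> k i"
    then have "P p i" using that by (simp add: P_def)
    then show "blk p \<noteq> 0 \<and> blk p \<le> i" using P_blk blk_le by (fastforce simp: P_def)
  qed
  then have H: "{p. blk p \<noteq> 0 \<and> blk p \<le> i} = {p. pos p \<le> k i}" if "1 \<le> i" "i \<le> t" for i
    using that by blast
  have k: "k i < CARD('n)" if "i \<le> t" for i using mono[OF that] assms(2) by simp
  have "blk p \<le> t" for p
  proof (cases "\<exists>j. P p j")
    case True
    then show ?thesis using P_blk by (auto simp: P_def)
  qed (simp add: blk_def)
  moreover have "card {p. blk p \<noteq> 0 \<and> blk p \<le> i} = Suc (k i)" if "1 \<le> i" "i \<le> t" for i
    unfolding H[OF that] using card_le_prefix[OF pos k[OF that(2)]] .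
  ultimately show ?thesis using that by blast
qed

lemma block_size_ge_diff:
  fixes blk :: "'n::finite \<Rightarrow> nat"
  assumes "\<And>i. 1 \<le> i \<Longrightarrow> i \<le> t \<Longrightarrow> card {p. blk p \<noteq> 0 \<and> blk p \<le> i} = Suc (k i)"
    and "1 \<le> i" and "i \<le> t"
  shows "k i - k (i - 1) \<le> block_size blk i"
proof -
  let ?H = "\<lambda>i. {p. blk p \<noteq> 0 \<and> blk p \<le> i}"
  have "{p. blk p = i} = ?H i - ?H (i - 1)" using assms(2) by auto
  moreover have "?H (i - 1) \<subseteq> ?H i" by auto
  ultimately have "block_size blk i = card (?H i) - card (?H (i - 1))"
    by (simp add: block_size_def card_Diff_subset)
  moreover have "card (?H (i - 1)) \<le> Suc (k (i - 1))"
  proof (cases "i = 1")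
    case True
    then have "?H (i - 1) = {}" by auto
    then show ?thesis by (metis card.empty zero_le)
  next
    case False
    then show ?thesis using assms(1)[of "i - 1"] assms(2,3) by simp
  qed
  ultimately show ?thesis using assms(1)[OF assms(2,3)] by simp
qed

theorem theorem3:
  fixes \<delta> :: real and t :: nat and k :: "nat \<Rightarrow> nat"
  assumes "0 < \<delta>" and "\<delta> < 1"
    and "k 0 = 0"
    and "\<forall>i<t. k i < k (Suc i)"
    and "k t < CARD('n)"
    and "CARD('n) \<le> CARD('m)"
  shows "\<exists>A :: real^'n^'m. \<forall>i\<in>{1..t}. \<forall>S :: 'n set. card S = k i \<longrightarrow>
           Er A S / OPT A (k i) \<ge> (1 - \<delta>) * (real (k i) - real (k (i - 1)))"
proof -
  obtain \<iota> :: "'n \<Rightarrow> 'm" where \<iota>: "inj \<iota>"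
    using card_le_inj[of "UNIV :: 'n set" "UNIV :: 'm set"] assms(6) by auto
  obtain blk :: "'n \<Rightarrow> nat" where
    card_blk: "\<And>i. 1 \<le> i \<Longrightarrow> i \<le> t \<Longrightarrow> card {p. blk p \<noteq> 0 \<and> blk p \<le> i} = Suc (k i)"
    and blk_le: "\<And>p. blk p \<le> t"
    using ex_block_labels[OF assms(4,5)] by blast
  define \<eta> where "\<eta> = \<delta> / (2 * real CARD('n))"
  show ?thesis
  proof (intro exI[of _ "embed_rows \<iota> (block_matrix blk (\<lambda>j. (\<eta>\<^sup>2) ^ j) \<eta>)"] ballI allI impI)
    fix i and S :: "'n set"
    assume i: "i \<in> {1..t}" and S: "card S = k i"
    have "k (i - 1) < k i" and "k i \<le> k t"
      using i strict_mono_on_prefix[OF assms(4), of "i - 1" i]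
        strict_mono_on_prefix[OF assms(4), of i t]
      by (auto simp: le_less)
    moreover have "{p. blk p \<noteq> 0} = {p. blk p \<noteq> 0 \<and> blk p \<le> t}" using blk_le by auto
    ultimately have "k i < card {p. blk p \<noteq> 0}" using card_blk[of t] i by simp
    moreover have "k i - k (i - 1) \<le> block_size blk i"
      by (rule block_size_ge_diff[OF card_blk]) (use i in auto)
    then have "real (k i) - real (k (i - 1)) \<le> real (block_size blk i)"
      using \<open>k (i - 1) < k i\<close> by (metis less_imp_le of_nat_diff of_nat_le_iff)
    ultimately show "(1 - \<delta>) * (real (k i) - real (k (i - 1)))
        \<le> Er (embed_rows \<iota> (block_matrix blk (\<lambda>j. (\<eta>\<^sup>2) ^ j) \<eta>)) S
          / OPT (embed_rows \<iota> (block_matrix blk (\<lambda>j. (\<eta>\<^sup>2) ^ j) \<eta>)) (k i)"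
      using ratio_embed_geometric_block_matrix_ge[OF \<iota> assms(1,2) _ card_blk _ S] i \<open>k (i - 1) < k i\<close>
      by (simp add: \<eta>_def)
  qed
qed

end
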